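(* Assume periodic boundary conditions, or the boundary conditions $\int_{\partial\Omega}\mathbf v\cdot\mathbf n\,ds=0$, $\int_{\partial\Omega}\boldsymbol\sigma\cdot\mathbf n\,ds=0$ and $\int_{\partial\Omega}\boldsymbol\beta\cdot\mathbf n\,ds=0$. Then the semi-discrete Lagrangian HTC scheme described in the context, with node values $\mathbf v_p,p_p,\rho_p,T_p,\boldsymbol\sigma_p,\boldsymbol\beta_p$ given by the $l_{pc}$-weighted averages and with the correction factor $\alpha_p$ obtained from the nodal compatibility condition, i.e. $\alpha_p=\nu_p/\delta_p$, is nonlinearly stable in the sense that it conserves total energy: $$\sum_c m_c\,\frac{dE_c}{dt}=0,$$ where $E_c$ is the specific total energy of cell $c$ and the sum is the discrete form of $\int_\Omega\rho\,\frac{dE}{dt}\,d\mathbf x$.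
   Context: **Mesh.** In two space dimensions, the moving domain $\Omega(t)$ with boundary $\partial\Omega(t)$ and outward unit normal $\mathbf n$ is discretized by non-overlapping triangles $\omega_c(t)$ of area $|\omega_c|$, with fixed topology and moving nodes $p$ at positions $\mathbf x_p$. $\mathcal P(c)$ is the set of vertices of $\omega_c$, and $\mathcal C(p)$ is the set of cells sharing node $p$. For $p\in\mathcal P(c)$ the corner normal is $l_{pc}\mathbf n_{pc}=l_{pc}^+\mathbf n_{pc}^++l_{pc}^-\mathbf n_{pc}^-$, where $l_{pc}^\pm$ are the half lengths of the two edges of $\omega_c$ meeting at $p$ and $\mathbf n_{pc}^\pm$ their outward unit normals; $\mathbf n_{pc}=(n_{pc}^k)_k$ is a unit vector and $l_{pc}$ the length of the corner normal. The sub-cell $\omega_{pc}$ is the quadrilateral obtained by connecting $\mathbf x_p$, the barycenter of $\omega_c$ and the midpoints of the two edges of $\omega_c$ at $p$. The dual cell is $\omega_p=\bigcup_{c\in\mathcal C(p)}\omega_{pc}$, of area $|\omega_p|$. Nodes move by $\frac{d\mathbf x_p}{dt}=\mathbf v_p$. **State and energy.** Each cell carries specific volume $\tau_c=1/\rho_c$ (with $\rho$ the density), velocity $\mathbf v_c$, specific entropy $S_c$, distortion field $\mathbf A_c$ and specific thermal impulse $\mathbf J_c$. The cell mass $m_c=\rho_c|\omega_c|$ is constant in time. The specific total energy is $E=E_1(\tau,S)+\frac12|\mathbf v|^2+\frac14c_s^2\,\mathring G_{ij}\mathring G_{ij}+\frac12c_h^2|\mathbf J|^2$, where $E_1$ is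 a given convex function (the equation of state), $\mathbf G=\mathbf A^T\mathbf A$, $\mathring G_{ij}=G_{ij}-\frac13G_{mm}\delta_{ij}$, and $c_s,c_h$ are constants. The dual variables are $p=-\partial E/\partial\tau$ (pressure), $T=\partial E/\partial S$ (temperature, assumed positive), $\boldsymbol\Gamma=\partial E/\partial\mathbf A$, $\boldsymbol\beta=\partial E/\partial\mathbf J$. The stress tensor is $\boldsymbol\sigma=\rho\mathbf A^T\boldsymbol\Gamma+\rho\,\mathbf J\otimes\boldsymbol\beta$. A subscript $c$ means evaluation at the state of cell $c$. $\theta_1=\theta_1(\tau_1)>0$ and $\theta_2=\theta_2(\tau_2)>0$ are given functions depending on relaxation times $\tau_1,\tau_2>0$. **Scheme** (summation over repeated component indices $i,k,l$): $$m_c\frac{d\tau_c}{dt}-\sum_{p\in\mathcal P(c)}l_{pc}\mathbf n_{pc}\cdot(\mathbf v_p-\mathbf v_c)=0,$$ $$m_c\frac{d v_c^i}{dt}+\sum_{p\in\mathcal P(c)}\Big(l_{pc}n_{pc}^i(p_p-p_c)+l_{pc}n_{pc}^k(\sigma_p^{ik}-\sigma_c^{ik})\Big)+\sum_{p\in\mathcal P(c)}l_{pc}(\alpha_p+\epsilon_p)(v_c^i-v_p^i)=0,$$ $$m_c\frac{dS_c}{dt}+\sum_{p\in\mathcal P(c)}l_{pc}\mathbf n_{pc}\cdot(\rho_p\boldsymbol\beta_p-\rho_c\boldsymbol\beta_c)=\Pi_c+\pi_c\ge0,$$ $$m_c\frac{dA_c^{ik}}{dt}+\rho_cA_c^{il}\sum_{p\in\mathcal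 P(c)}l_{pc}n_{pc}^k(v_p^l-v_c^l)=-\frac1{\theta_1}\Gamma_c^{ik},$$ $$m_c\frac{dJ_c^i}{dt}+\rho_cJ_c^l\sum_{p\in\mathcal P(c)}l_{pc}n_{pc}^i(v_p^l-v_c^l)+\rho_c\sum_{p\in\mathcal P(c)}l_{pc}n_{pc}^i(T_p-T_c)+\rho_c\sum_{p\in\mathcal P(c)}l_{pc}n_{pc}^i(\alpha_p+\epsilon_p)D_p=-\frac1{\theta_2}\beta_c^i,$$ where $D_p=\sum_{c\in\mathcal C(p)}l_{pc}\mathbf n_{pc}\cdot\rho_c\boldsymbol\beta_c$ (up to sign, the volume-integrated discrete divergence of $\rho\boldsymbol\beta$ on the dual cell), $\epsilon_p\ge0$ is a numerical viscosity, and each nodal value is the average $q_p=\big(\sum_{c\in\mathcal C(p)}l_{pc}q_c\big)/\sum_{c\in\mathcal C(p)}l_{pc}$ for $q\in\{\mathbf v,p,\rho,T,\boldsymbol\sigma,\boldsymbol\beta\}$. The entropy production terms are $\pi_c=\frac{\boldsymbol\Gamma_c:\boldsymbol\Gamma_c}{T_c\theta_1}+\frac{\boldsymbol\beta_c\cdot\boldsymbol\beta_c}{T_c\theta_2}$ and $\Pi_c=\sum_{p\in\mathcal P(c)}\frac{|\omega_{pc}|}{|\omega_c|}\frac{\Pi_p}{T_c}$ with $\Pi_p=\epsilon_p\delta_p$ and $\delta_p=\sum_{c\in\mathcal C(p)}l_{pc}|\mathbf v_c-\mathbf v_p|^2+D_p^2\ge0$. **Correction factor.** $\alpha_p$ is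 obtained by requiring that the sum of the total energy fluctuations around a node $p$ equals the sum of the total energy fluxes through the boundary of the dual cell: $$\sum_{c\in\mathcal C(p)}l_{pc}n_{pc}^k\Big(p_c(v_p^k-v_c^k)+v_c^k(p_p-p_c)+(\sigma_p^{ik}-\sigma_c^{ik})v_c^i+T_c(\rho_p\beta_p^k-\rho_c\beta_c^k)+\rho_c\Gamma_c^{ik}A_c^{il}(v_p^l-v_c^l)+\rho_c\beta_c^kJ_c^l(v_p^l-v_c^l)+\rho_c\beta_c^k(T_p-T_c)\Big)+\alpha_p\delta_p=-\sum_{c\in\mathcal C(p)}l_{pc}n_{pc}^k\Big(p_cv_c^k+\sigma_c^{ik}v_c^i+\rho_cT_c\beta_c^k\Big).$$ Solving for $\alpha_p$ gives $\alpha_p=\nu_p/\delta_p$ with $$\nu_p=\sum_{c\in\mathcal C(p)}l_{pc}n_{pc}^k\Big(p_cv_c^k-p_cv_p^k-p_pv_c^k+\sigma_c^{ik}v_c^i-\sigma_c^{ik}v_p^i-\sigma_p^{ik}v_c^i+T_c\rho_c\beta_c^k-T_c\rho_p\beta_p^k-T_p\rho_c\beta_c^k\Big).$$ For $\delta_p=0$ one sets $\alpha_p=0$.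
   Formalization: Π_c uses the weight |ω_pc|/|ω_p| instead of the printed |ω_pc|/|ω_c|; the printed weight is covered only if Σ_c T_cΠ_c = Σ_p Π_p. At nodes with δ_p = 0 the nodal compatibility condition is assumed (with α_p = 0). E_1 is assumed differentiable. *)

theory Defs
  imports "HOL-Analysis.Analysis"
begin

section \<open>Triangular meshes at a fixed time\<close>

text \<open>
  \<open>verts g c\<close> is \<open>P(c)\<close>. \<open>pos g c p\<close> is the position of node \<open>p\<close> as seen from cell \<open>c\<close>:
  on a periodic mesh the same node can appear as a corner of two cells at positions
  that differ by a period.
\<close>

record ('c, 'p) mesh =
  verts :: "'c \<Rightarrow> 'p set"
  pos :: "'c \<Rightarrow> 'p \<Rightarrow> real^2"

definition cells_at :: "('c, 'p) mesh \<Rightarrow> 'p \<Rightarrow> 'c set" where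
  "cells_at g p = {c. p \<in> verts g c}"

definition rot :: "real^2 \<Rightarrow> real^2" where
  "rot w = vector [w $ 2, - w $ 1]"

definition opposite :: "('c, 'p) mesh \<Rightarrow> 'c \<Rightarrow> 'p \<Rightarrow> 'p \<Rightarrow> 'p" where
  "opposite g c p q = the_elem (verts g c - {p, q})"

definition edge_length :: "('c, 'p) mesh \<Rightarrow> 'c \<Rightarrow> 'p \<Rightarrow> 'p \<Rightarrow> real" where
  "edge_length g c p q = norm (pos g c q - pos g c p)"

text \<open>The unit normal of the edge \<open>pq\<close> pointing away from the third vertex of \<open>c\<close>.\<close>

definition outer_normal :: "('c, 'p) mesh \<Rightarrow> 'c \<Rightarrow> 'p \<Rightarrow> 'p \<Rightarrow> real^2" where
  "outer_normal g c p q =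
     (let d = sgn (rot (pos g c q - pos g c p))
      in - sgn (d \<bullet> (pos g c (opposite g c p q) - pos g c p)) *\<^sub>R d)"

text \<open>The corner normal; the two terms of the sum are the two edges of \<open>c\<close> that meet at \<open>p\<close>.\<close>

definition corner :: "('c, 'p) mesh \<Rightarrow> 'p \<Rightarrow> 'c \<Rightarrow> real^2" where
  "corner g p c = (\<Sum>q\<in>verts g c - {p}. (edge_length g c p q / 2) *\<^sub>R outer_normal g c p q)"

definition len :: "('c, 'p) mesh \<Rightarrow> 'p \<Rightarrow> 'c \<Rightarrow> real" where
  "len g p c = norm (corner g p c)"

definition nrm :: "('c, 'p) mesh \<Rightarrow> 'p \<Rightarrow> 'c \<Rightarrow> real^2" where
  "nrm g p c = sgn (corner g p c)"

definition cell_region :: "('c, 'p) mesh \<Rightarrow> 'c \<Rightarrow> (real^2) set" where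
  "cell_region g c = convex hull (pos g c ` verts g c)"

definition cell_area :: "('c, 'p) mesh \<Rightarrow> 'c \<Rightarrow> real" where
  "cell_area g c = measure lebesgue (cell_region g c)"

definition barycenter :: "('c, 'p) mesh \<Rightarrow> 'c \<Rightarrow> real^2" where
  "barycenter g c = (\<Sum>q\<in>verts g c. pos g c q) /\<^sub>R 3"

text \<open>The quadrilateral \<open>\<omega>\<^sub>p\<^sub>c\<close> is convex, hence the hull of its four corners.\<close>

definition subcell_area :: "('c, 'p) mesh \<Rightarrow> 'p \<Rightarrow> 'c \<Rightarrow> real" where
  "subcell_area g p c = measure lebesgue
     (convex hull ({pos g c p, barycenter g c} \<union>
        (\<lambda>q. midpoint (pos g c p) (pos g c q)) ` (verts g c - {p})))"

text \<open>The sub-cells of a dual cell do not overlap, so its area is the sum of theirs; this also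
  makes sense for the dual cells that cross a periodic boundary.\<close>

definition dual_area :: "('c, 'p) mesh \<Rightarrow> 'p \<Rightarrow> real" where
  "dual_area g p = (\<Sum>c\<in>cells_at g p. subcell_area g p c)"

text \<open>\<open>L\<close> is the group of periods: \<open>{0}\<close> for a bounded domain, a lattice for a periodic one.\<close>

definition triangulation :: "(real^2) set \<Rightarrow> ('c, 'p) mesh \<Rightarrow> bool" where
  "triangulation L g \<longleftrightarrow>
     (\<forall>c. card (verts g c) = 3 \<and> \<not> collinear (pos g c ` verts g c)) \<and>
     (\<Union>c. verts g c) = UNIV \<and>
     (\<forall>c c'. \<forall>z\<in>L. (c, 0) \<noteq> (c', z) \<longrightarrow>
        interior (cell_region g c) \<inter> interior ((+) z ` cell_region g c') = {})"

definition lattice :: "real^2 \<Rightarrow> real^2 \<Rightarrow> (real^2) set" where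
  "lattice a b = {of_int i *\<^sub>R a + of_int j *\<^sub>R b | i j. True}"

text \<open>An edge \<open>pq\<close> of \<open>c\<close> lies on the boundary if no other cell has it as an edge. On a periodic
  mesh two cells share an edge if they do so up to a translation.\<close>

definition boundary_edge :: "('c, 'p) mesh \<Rightarrow> 'c \<Rightarrow> 'p \<Rightarrow> 'p \<Rightarrow> bool" where
  "boundary_edge g c p q \<longleftrightarrow> p \<noteq> q \<and> {p, q} \<subseteq> verts g c \<and>
     \<not> (\<exists>c'. c' \<noteq> c \<and> {p, q} \<subseteq> verts g c' \<and> pos g c' q - pos g c' p = pos g c q - pos g c p)"

text \<open>
  The integral over the polygonal boundary of \<open>f n\<close>, where \<open>f\<close> interpolates nodal values
  \<open>f\<^sub>p\<close> linearly on each boundary edge and \<open>B f n\<close> is the product of \<open>f\<close> with the normal. Every edge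
  occurs twice, as \<open>pq\<close> and as \<open>qp\<close>; each occurrence contributes the half edge next to its
  first node.
\<close>

definition boundary_integral ::
  "('c::finite, 'p) mesh \<Rightarrow> ('a \<Rightarrow> real^2 \<Rightarrow> 'b::real_vector) \<Rightarrow> ('p \<Rightarrow> 'a) \<Rightarrow> 'b" where
  "boundary_integral g B f =
     (\<Sum>c\<in>UNIV. \<Sum>p\<in>verts g c. \<Sum>q | boundary_edge g c p q.
        (edge_length g c p q / 2) *\<^sub>R B (f p) (outer_normal g c p q))"

definition node_avg :: "('c, 'p) mesh \<Rightarrow> ('c \<Rightarrow> 'a::real_vector) \<Rightarrow> 'p \<Rightarrow> 'a" where
  "node_avg g q p =
     (\<Sum>c\<in>cells_at g p. len g p c *\<^sub>R q c) /\<^sub>R (\<Sum>c\<in>cells_at g p. len g p c)"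


section \<open>State, energy and dual variables\<close>

record cell_state =
  svol :: real
  entr :: real
  velo :: "real^2"
  dstn :: "real^2^2"
  impl :: "real^2"

text \<open>\<open>eos\<close> is \<open>E\<^sub>1\<close>; \<open>th1\<close>, \<open>th2\<close> are the functions \<open>\<theta>\<^sub>1\<close>, \<open>\<theta>\<^sub>2\<close> of the relaxation
  times \<open>rel1\<close>, \<open>rel2\<close>.\<close>

record model =
  eos :: "real \<Rightarrow> real \<Rightarrow> real"
  c_s :: real
  c_h :: real
  th1 :: "real \<Rightarrow> real"
  th2 :: "real \<Rightarrow> real"
  rel1 :: real
  rel2 :: real

abbreviation theta1 :: "model \<Rightarrow> real" where "theta1 M \<equiv> th1 M (rel1 M)"
abbreviation theta2 :: "model \<Rightarrow> real" where "theta2 M \<equiv> th2 M (rel2 M)"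

text \<open>\<open>U\<close> is the open domain of \<open>(\<tau>, S)\<close> on which the equation of state is given.\<close>

definition admissible_model :: "(real \<times> real) set \<Rightarrow> model \<Rightarrow> bool" where
  "admissible_model U M \<longleftrightarrow>
     open U \<and> convex_on U (\<lambda>(vol, S). eos M vol S) \<and>
     (\<forall>z\<in>U. (\<lambda>(vol, S). eos M vol S) differentiable (at z)) \<and>
     rel1 M > 0 \<and> rel2 M > 0 \<and> theta1 M > 0 \<and> theta2 M > 0"

definition metric :: "real^2^2 \<Rightarrow> real^2^2" where
  "metric A = transpose A ** A"

text \<open>The factor 1/3 is kept in two space dimensions.\<close>

definition metric_dev :: "real^2^2 \<Rightarrow> real^2^2" where
  "metric_dev A = metric A - (1/3 * trace (metric A)) *\<^sub>R mat 1"

definition energy :: "model \<Rightarrow> cell_state \<Rightarrow> real" where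
  "energy M s = eos M (svol s) (entr s) + 1/2 * (norm (velo s))\<^sup>2
     + 1/4 * (c_s M)\<^sup>2 * (\<Sum>i\<in>UNIV. \<Sum>j\<in>UNIV. metric_dev (dstn s) $ i $ j * metric_dev (dstn s) $ i $ j)
     + 1/2 * (c_h M)\<^sup>2 * (norm (impl s))\<^sup>2"

definition dens :: "cell_state \<Rightarrow> real" where
  "dens s = 1 / svol s"

definition press :: "model \<Rightarrow> cell_state \<Rightarrow> real" where
  "press M s = - deriv (\<lambda>x. energy M (s\<lparr>svol := x\<rparr>)) (svol s)"

definition temp :: "model \<Rightarrow> cell_state \<Rightarrow> real" where
  "temp M s = deriv (\<lambda>x. energy M (s\<lparr>entr := x\<rparr>)) (entr s)"

definition upd_vec :: "'a^'n \<Rightarrow> 'n \<Rightarrow> 'a \<Rightarrow> 'a^'n" where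
  "upd_vec w i x = (\<chi> j. if j = i then x else w $ j)"

definition Gam :: "model \<Rightarrow> cell_state \<Rightarrow> real^2^2" where
  "Gam M s = (\<chi> i k. deriv (\<lambda>x. energy M (s\<lparr>dstn := upd_vec (dstn s) i (upd_vec (dstn s $ i) k x)\<rparr>))
                        (dstn s $ i $ k))"

definition bet :: "model \<Rightarrow> cell_state \<Rightarrow> real^2" where
  "bet M s = (\<chi> i. deriv (\<lambda>x. energy M (s\<lparr>impl := upd_vec (impl s) i x\<rparr>)) (impl s $ i))"

definition outer :: "real^2 \<Rightarrow> real^2 \<Rightarrow> real^2^2" where
  "outer a b = (\<chi> i k. a $ i * b $ k)"

definition stress :: "model \<Rightarrow> cell_state \<Rightarrow> real^2^2" where
  "stress M s = dens s *\<^sub>R (transpose (dstn s) ** Gam M s) + dens s *\<^sub>R outer (impl s) (bet M s)"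


section \<open>Nodal quantities\<close>

text \<open>\<open>s c\<close> is the state of cell \<open>c\<close>.\<close>

abbreviation nvel :: "('c, 'p) mesh \<Rightarrow> ('c \<Rightarrow> cell_state) \<Rightarrow> 'p \<Rightarrow> real^2" where
  "nvel g s \<equiv> node_avg g (\<lambda>c. velo (s c))"
abbreviation ndens :: "('c, 'p) mesh \<Rightarrow> ('c \<Rightarrow> cell_state) \<Rightarrow> 'p \<Rightarrow> real" where
  "ndens g s \<equiv> node_avg g (\<lambda>c. dens (s c))"
abbreviation npress :: "model \<Rightarrow> ('c, 'p) mesh \<Rightarrow> ('c \<Rightarrow> cell_state) \<Rightarrow> 'p \<Rightarrow> real" where
  "npress M g s \<equiv> node_avg g (\<lambda>c. press M (s c))"
abbreviation ntemp :: "model \<Rightarrow> ('c, 'p) mesh \<Rightarrow> ('c \<Rightarrow> cell_state) \<Rightarrow> 'p \<Rightarrow> real" where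
  "ntemp M g s \<equiv> node_avg g (\<lambda>c. temp M (s c))"
abbreviation nstress :: "model \<Rightarrow> ('c, 'p) mesh \<Rightarrow> ('c \<Rightarrow> cell_state) \<Rightarrow> 'p \<Rightarrow> real^2^2" where
  "nstress M g s \<equiv> node_avg g (\<lambda>c. stress M (s c))"
abbreviation nbet :: "model \<Rightarrow> ('c, 'p) mesh \<Rightarrow> ('c \<Rightarrow> cell_state) \<Rightarrow> 'p \<Rightarrow> real^2" where
  "nbet M g s \<equiv> node_avg g (\<lambda>c. bet M (s c))"

definition Dnode :: "model \<Rightarrow> ('c, 'p) mesh \<Rightarrow> ('c \<Rightarrow> cell_state) \<Rightarrow> 'p \<Rightarrow> real" where
  "Dnode M g s p = (\<Sum>c\<in>cells_at g p. len g p c * (nrm g p c \<bullet> (dens (s c) *\<^sub>R bet M (s c))))"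

definition delta :: "model \<Rightarrow> ('c, 'p) mesh \<Rightarrow> ('c \<Rightarrow> cell_state) \<Rightarrow> 'p \<Rightarrow> real" where
  "delta M g s p =
     (\<Sum>c\<in>cells_at g p. len g p c * (norm (velo (s c) - nvel g s p))\<^sup>2) + (Dnode M g s p)\<^sup>2"

definition nu :: "model \<Rightarrow> ('c, 'p) mesh \<Rightarrow> ('c \<Rightarrow> cell_state) \<Rightarrow> 'p \<Rightarrow> real" where
  "nu M g s p = (\<Sum>c\<in>cells_at g p. \<Sum>k\<in>UNIV. len g p c * nrm g p c $ k *
     (press M (s c) * velo (s c) $ k - press M (s c) * nvel g s p $ k - npress M g s p * velo (s c) $ k
      + (\<Sum>i\<in>UNIV. stress M (s c) $ i $ k * velo (s c) $ i - stress M (s c) $ i $ k * nvel g s p $ i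
                  - nstress M g s p $ i $ k * velo (s c) $ i)
      + temp M (s c) * dens (s c) * bet M (s c) $ k
      - temp M (s c) * ndens g s p * nbet M g s p $ k
      - ntemp M g s p * dens (s c) * bet M (s c) $ k))"

definition alpha :: "model \<Rightarrow> ('c, 'p) mesh \<Rightarrow> ('c \<Rightarrow> cell_state) \<Rightarrow> 'p \<Rightarrow> real" where
  "alpha M g s p = (if delta M g s p = 0 then 0 else nu M g s p / delta M g s p)"

text \<open>With correction factor \<open>a\<close>, the energy fluctuations around \<open>p\<close> add up to the energy flux
  through the boundary of the dual cell.\<close>

definition nodal_compatibility ::
  "model \<Rightarrow> ('c, 'p) mesh \<Rightarrow> ('c \<Rightarrow> cell_state) \<Rightarrow> 'p \<Rightarrow> real \<Rightarrow> bool" where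
  "nodal_compatibility M g s p a \<longleftrightarrow>
     (\<Sum>c\<in>cells_at g p. \<Sum>k\<in>UNIV. len g p c * nrm g p c $ k *
       (press M (s c) * (nvel g s p $ k - velo (s c) $ k)
        + velo (s c) $ k * (npress M g s p - press M (s c))
        + (\<Sum>i\<in>UNIV. (nstress M g s p $ i $ k - stress M (s c) $ i $ k) * velo (s c) $ i)
        + temp M (s c) * (ndens g s p * nbet M g s p $ k - dens (s c) * bet M (s c) $ k)
        + (\<Sum>i\<in>UNIV. \<Sum>l\<in>UNIV. dens (s c) * Gam M (s c) $ i $ k * dstn (s c) $ i $ l
             * (nvel g s p $ l - velo (s c) $ l))
        + (\<Sum>l\<in>UNIV. dens (s c) * bet M (s c) $ k * impl (s c) $ l * (nvel g s p $ l - velo (s c) $ l))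
        + dens (s c) * bet M (s c) $ k * (ntemp M g s p - temp M (s c))))
     + a * delta M g s p
     = - (\<Sum>c\<in>cells_at g p. \<Sum>k\<in>UNIV. len g p c * nrm g p c $ k *
           (press M (s c) * velo (s c) $ k
            + (\<Sum>i\<in>UNIV. stress M (s c) $ i $ k * velo (s c) $ i)
            + dens (s c) * temp M (s c) * bet M (s c) $ k))"


section \<open>Entropy production\<close>

definition Pi_node :: "model \<Rightarrow> ('p \<Rightarrow> real) \<Rightarrow> ('c, 'p) mesh \<Rightarrow> ('c \<Rightarrow> cell_state) \<Rightarrow> 'p \<Rightarrow> real" where
  "Pi_node M eps g s p = eps p * delta M g s p"

text \<open>
  \<open>\<Pi>\<^sub>p\<close> is the production in the whole dual cell. Its share for cell \<open>c\<close> is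
  \<open>|\<omega>\<^sub>p\<^sub>c| / |\<omega>\<^sub>p|\<close> (\<open>dual_weight\<close>), which sums to 1 over the cells around \<open>p\<close>.
  \<open>cell_weight\<close>, i.e. \<open>|\<omega>\<^sub>p\<^sub>c| / |\<omega>\<^sub>c|\<close>, is always 1/3 for a triangle and sums to 1 only if exactly
  three cells meet at \<open>p\<close>. The weight is therefore a parameter of the scheme.
\<close>

definition dual_weight :: "('c, 'p) mesh \<Rightarrow> 'p \<Rightarrow> 'c \<Rightarrow> real" where
  "dual_weight g p c = subcell_area g p c / dual_area g p"

definition cell_weight :: "('c, 'p) mesh \<Rightarrow> 'p \<Rightarrow> 'c \<Rightarrow> real" where
  "cell_weight g p c = subcell_area g p c / cell_area g c"

definition Pi_cell ::
  "(('c, 'p) mesh \<Rightarrow> 'p \<Rightarrow> 'c \<Rightarrow> real) \<Rightarrow> model \<Rightarrow> ('p \<Rightarrow> real) \<Rightarrow> ('c, 'p) mesh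
     \<Rightarrow> ('c \<Rightarrow> cell_state) \<Rightarrow> 'c \<Rightarrow> real" where
  "Pi_cell w M eps g s c = (\<Sum>p\<in>verts g c. w g p c * (Pi_node M eps g s p / temp M (s c)))"

definition pi_cell :: "model \<Rightarrow> cell_state \<Rightarrow> real" where
  "pi_cell M s = (\<Sum>i\<in>UNIV. \<Sum>k\<in>UNIV. Gam M s $ i $ k * Gam M s $ i $ k) / (temp M s * theta1 M)
               + (bet M s \<bullet> bet M s) / (temp M s * theta2 M)"


section \<open>The semi-discrete scheme\<close>

text \<open>\<open>x p t\<close> is the node position; \<open>off c p\<close> is the constant period that must be added to it to
  obtain the corner of \<open>c\<close>.\<close>

definition mesh_at ::
  "('c \<Rightarrow> 'p set) \<Rightarrow> ('c \<Rightarrow> 'p \<Rightarrow> real^2) \<Rightarrow> ('p \<Rightarrow> real \<Rightarrow> real^2) \<Rightarrow> real \<Rightarrow> ('c, 'p) mesh" where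
  "mesh_at K off x t = \<lparr>verts = K, pos = (\<lambda>c p. x p t + off c p)\<rparr>"

definition htc_scheme ::
  "(('c::finite, 'p::finite) mesh \<Rightarrow> 'p \<Rightarrow> 'c \<Rightarrow> real) \<Rightarrow> model \<Rightarrow> (real \<times> real) set
     \<Rightarrow> ('p \<Rightarrow> real \<Rightarrow> real) \<Rightarrow> ('c \<Rightarrow> real)
     \<Rightarrow> ('c \<Rightarrow> 'p set) \<Rightarrow> ('c \<Rightarrow> 'p \<Rightarrow> real^2) \<Rightarrow> ('p \<Rightarrow> real \<Rightarrow> real^2)
     \<Rightarrow> ('c \<Rightarrow> real \<Rightarrow> cell_state) \<Rightarrow> real \<Rightarrow> bool" where
  "htc_scheme w M U eps m K off x u t \<longleftrightarrow>
    (let g = mesh_at K off x t; s = (\<lambda>c. u c t); e = (\<lambda>p. eps p t) in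
     (\<forall>p. e p \<ge> 0 \<and> (x p has_vector_derivative nvel g s p) (at t)) \<and>
     (\<forall>c.
       svol (s c) > 0 \<and> (svol (s c), entr (s c)) \<in> U \<and> temp M (s c) > 0 \<and>
       m c = dens (s c) * cell_area g c \<and>
       (\<lambda>r. svol (u c r)) differentiable (at t) \<and>
       (\<lambda>r. entr (u c r)) differentiable (at t) \<and>
       (\<lambda>r. velo (u c r)) differentiable (at t) \<and>
       (\<lambda>r. dstn (u c r)) differentiable (at t) \<and>
       (\<lambda>r. impl (u c r)) differentiable (at t) \<and>
       m c * deriv (\<lambda>r. svol (u c r)) t
         - (\<Sum>p\<in>verts g c. len g p c * (nrm g p c \<bullet> (nvel g s p - velo (s c)))) = 0 \<and>
       (\<forall>i. m c * deriv (\<lambda>r. velo (u c r) $ i) t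
         + (\<Sum>p\<in>verts g c. len g p c * nrm g p c $ i * (npress M g s p - press M (s c))
             + (\<Sum>k\<in>UNIV. len g p c * nrm g p c $ k * (nstress M g s p $ i $ k - stress M (s c) $ i $ k)))
         + (\<Sum>p\<in>verts g c. len g p c * (alpha M g s p + e p) * (velo (s c) $ i - nvel g s p $ i)) = 0) \<and>
       m c * deriv (\<lambda>r. entr (u c r)) t
         + (\<Sum>p\<in>verts g c. len g p c *
             (nrm g p c \<bullet> (ndens g s p *\<^sub>R nbet M g s p - dens (s c) *\<^sub>R bet M (s c))))
         = Pi_cell w M e g s c + pi_cell M (s c) \<and>
       (\<forall>i k. m c * deriv (\<lambda>r. dstn (u c r) $ i $ k) t
         + (\<Sum>l\<in>UNIV. dens (s c) * dstn (s c) $ i $ l *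
             (\<Sum>p\<in>verts g c. len g p c * nrm g p c $ k * (nvel g s p $ l - velo (s c) $ l)))
         = - (1 / theta1 M) * Gam M (s c) $ i $ k) \<and>
       (\<forall>i. m c * deriv (\<lambda>r. impl (u c r) $ i) t
         + (\<Sum>l\<in>UNIV. dens (s c) * impl (s c) $ l *
             (\<Sum>p\<in>verts g c. len g p c * nrm g p c $ i * (nvel g s p $ l - velo (s c) $ l)))
         + dens (s c) * (\<Sum>p\<in>verts g c. len g p c * nrm g p c $ i * (ntemp M g s p - temp M (s c)))
         + dens (s c) * (\<Sum>p\<in>verts g c. len g p c * nrm g p c $ i * (alpha M g s p + e p) * Dnode M g s p)
         = - (1 / theta2 M) * bet M (s c) $ i)))"

text \<open>Boundary conditions. The domain of a periodic mesh is a torus, without boundary edges.\<close>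

definition periodic_mesh ::
  "('c \<Rightarrow> 'p set) \<Rightarrow> ('c \<Rightarrow> 'p \<Rightarrow> real^2) \<Rightarrow> ('p \<Rightarrow> real \<Rightarrow> real^2) \<Rightarrow> real set \<Rightarrow> bool" where
  "periodic_mesh K off x I \<longleftrightarrow>
     (\<exists>a b. a \<noteq> b \<and> independent {a, b} \<and> (\<forall>c p. off c p \<in> lattice a b) \<and>
        (\<forall>t\<in>I. triangulation (lattice a b) (mesh_at K off x t) \<and>
           (\<forall>c p q. \<not> boundary_edge (mesh_at K off x t) c p q)))"

definition zero_boundary_fluxes ::
  "model \<Rightarrow> ('c::finite \<Rightarrow> 'p set) \<Rightarrow> ('c \<Rightarrow> 'p \<Rightarrow> real^2) \<Rightarrow> ('p \<Rightarrow> real \<Rightarrow> real^2)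
     \<Rightarrow> ('c \<Rightarrow> real \<Rightarrow> cell_state) \<Rightarrow> real set \<Rightarrow> bool" where
  "zero_boundary_fluxes M K off x u I \<longleftrightarrow>
     (\<forall>c p. off c p = 0) \<and>
     (\<forall>t\<in>I. let g = mesh_at K off x t; s = (\<lambda>c. u c t) in
        triangulation {0} g \<and>
        boundary_integral g (\<bullet>) (nvel g s) = 0 \<and>
        boundary_integral g (*v) (nstress M g s) = 0 \<and>
        boundary_integral g (\<bullet>) (nbet M g s) = 0)"

end

theory Submission
  imports Defs
begin

text \<open>
  The chain rule turns \<open>m\<^sub>c dE\<^sub>c/dt\<close> into the scheme equations weighted with the dual variables. The
  relaxation terms cancel against \<open>\<pi>\<^sub>c\<close>. Summed over the cells around a node, the viscous terms give
  \<open>(\<alpha>\<^sub>p + \<epsilon>\<^sub>p) \<delta>\<^sub>p\<close>, because the nodal velocity is the weighted average, and \<open>\<epsilon>\<^sub>p \<delta>\<^sub>p\<close> cancels against the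
  production \<open>\<Pi>\<^sub>p\<close>. By nodal compatibility the rest is a sum of corner normals times a quantity that
  depends on the cell only, and the corner normals of a triangle add up to zero.
\<close>

section \<open>Corner normals of a triangle\<close>

lemma norm_rot: "norm (rot v) = norm v"
  by (simp add: norm_vec_def L2_set_def UNIV_2 rot_def add.commute)

lemma rot_minus: "rot (- v) = - rot v"
  by (simp add: rot_def vec_eq_iff forall_2)

lemma rot_add: "rot (v + w) = rot v + rot w"
  by (simp add: rot_def vec_eq_iff forall_2)

text \<open>Both sides are minus twice the signed area of the triangle \<open>a b c\<close>, which
  is invariant under cyclic relabelling and, in the next lemma, changes sign under a
  transposition.\<close>

lemma rot_orientation_cyclic: "rot (c - b) \<bullet> (a - b) = rot (b - a) \<bullet> (c - a)"
  by (simp add: rot_def inner_vec_def UNIV_2 algebra_simps)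

lemma rot_orientation_swap: "rot (a - b) \<bullet> (c - b) = - (rot (b - a) \<bullet> (c - a))"
  by (simp add: rot_def inner_vec_def UNIV_2 algebra_simps)

text \<open>The edge length cancels the normalisation of the rotated edge vector. What remains is
  linear in the edge vector up to an orientation sign, so contributions of different edges can be
  added.\<close>

lemma scaled_outer_normal:
  fixes g :: "('c, 'p) mesh" and c :: 'c
  defines "P \<equiv> pos g c"
  assumes "opposite g c p q = r"
  shows "(edge_length g c p q / 2) *\<^sub>R outer_normal g c p q
           = - (sgn (rot (P q - P p) \<bullet> (P r - P p)) / 2) *\<^sub>R rot (P q - P p)"
proof -
  have sgn_d: "sgn (sgn v \<bullet> z) = sgn (v \<bullet> z)" for v z :: "real^2"
    by (cases "v = 0") (simp_all add: sgn_div_norm[of v] sgn_mult)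
  have len_d: "norm (P q - P p) *\<^sub>R sgn (rot (P q - P p)) = rot (P q - P p)"
    by (cases "P q - P p = 0") (auto simp: sgn_div_norm norm_rot, simp add: rot_def vec_eq_iff forall_2)
  have "(edge_length g c p q / 2) *\<^sub>R outer_normal g c p q
      = - (sgn (rot (P q - P p) \<bullet> (P r - P p)) / 2) *\<^sub>R
          (norm (P q - P p) *\<^sub>R sgn (rot (P q - P p)))"
    using assms by (simp add: outer_normal_def Let_def edge_length_def sgn_d P_def mult.commute)
  then show ?thesis by (simp only: len_d)
qed

text \<open>Each edge contributes its rotated edge vector with one common orientation sign, and the
  edge vectors of a triangle add up to zero.\<close>

lemma sum_corner_eq_0:
  assumes "card (verts g c) = 3"
  shows "(\<Sum>p\<in>verts g c. corner g p c) = 0"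
proof -
  obtain a b d where V: "verts g c = {a, b, d}" and ne: "a \<noteq> b" "b \<noteq> d" "a \<noteq> d"
    using assms by (auto simp: card_3_iff)
  define P where "P = pos g c"
  define \<sigma> where "\<sigma> = sgn (rot (P b - P a) \<bullet> (P d - P a))"
  define N where "N p q = (edge_length g c p q / 2) *\<^sub>R outer_normal g c p q" for p q
  have opp: "opposite g c p q = r" if "{a, b, d} - {p, q} = {r}" for p q r
    using that by (simp add: opposite_def V)
  have edge: "N p q = - (sgn (rot (P q - P p) \<bullet> (P r - P p)) / 2) *\<^sub>R rot (P q - P p)"
    if "{a, b, d} - {p, q} = {r}" for p q r
    unfolding N_def P_def by (rule scaled_outer_normal[OF opp[OF that]])
  have \<sigma>: "sgn (rot (P d - P b) \<bullet> (P a - P b)) = \<sigma>" "sgn (rot (P a - P d) \<bullet> (P b - P d)) = \<sigma>"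
    unfolding \<sigma>_def by (metis rot_orientation_cyclic)+
  \<comment> \<open>Reversing the edge changes the sign of both the rotated edge vector and the
    orientation, so the outward normal does not depend on the direction of traversal.\<close>
  have flip: "N q p = N p q" if "{a, b, d} - {p, q} = {r}" for p q r
  proof -
    have "{a, b, d} - {q, p} = {r}" using that by (simp add: insert_commute)
    then show ?thesis
      using edge[OF that] edge[of q p r] rot_minus[of "P q - P p"]
        rot_orientation_swap[of "P p" "P q" "P r"]
      by (simp add: sgn_minus)
  qed
  have V': "{a, b, d} - {a, b} = {d}" "{a, b, d} - {b, d} = {a}" "{a, b, d} - {d, a} = {b}"
    using ne by auto
  have E: "N a b = - (\<sigma> / 2) *\<^sub>R rot (P b - P a)" "N b d = - (\<sigma> / 2) *\<^sub>R rot (P d - P b)"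
    "N d a = - (\<sigma> / 2) *\<^sub>R rot (P a - P d)"
    using edge[OF V'(1)] edge[OF V'(2)] edge[OF V'(3)] \<sigma> by (simp_all add: \<sigma>_def)
  have F: "N b a = N a b" "N d b = N b d" "N a d = N d a"
    using flip[OF V'(1)] flip[OF V'(2)] flip[OF V'(3)] by simp_all
  have "rot (P b - P a) + rot (P d - P b) + rot (P a - P d) = rot 0"
    unfolding rot_add[symmetric] by simp
  then have loop: "rot (P b - P a) + rot (P d - P b) + rot (P a - P d) = 0"
    by (simp add: rot_def vec_eq_iff forall_2)
  have "(\<Sum>p\<in>verts g c. corner g p c) = N a b + N a d + (N b a + N b d) + (N d a + N d b)"
    using ne by (simp add: corner_def V N_def insert_Diff_if ac_simps)
  \<comment> \<open>Each edge contributes a half at both of its end points, so the factors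
    \<open>\<sigma> / 2\<close> double to \<open>\<sigma>\<close>.\<close>
  also have "\<dots> = - \<sigma> *\<^sub>R (rot (P b - P a) + rot (P d - P b) + rot (P a - P d))"
    by (simp add: E F vec_eq_iff algebra_simps)
  finally show ?thesis by (simp add: loop)
qed

section \<open>Positive areas and the dual weights\<close>

text \<open>The barycenter of the nondegenerate triangle \<open>a b c\<close> is an interior point
  of the hull, so the hull is not negligible; by compactness its measure is finite.\<close>

lemma measure_convex_hull_pos:
  fixes a b c :: "real^2"
  assumes "finite S" "{a, b, c} \<subseteq> S" "\<not> collinear {a, b, c}"
  shows "measure lebesgue (convex hull S) > 0"
proof -
  have "(1/3) *\<^sub>R a + (1/3) *\<^sub>R b + (1/3) *\<^sub>R c \<in> interior (convex hull {a, b, c})"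
    unfolding interior_convex_hull_3_minimal[OF assms(3), simplified] mem_Collect_eq
    by (intro exI[of _ "1/3"] conjI) simp_all
  then have "interior (convex hull S) \<noteq> {}"
    using interior_mono[OF hull_mono[OF assms(2), of convex]] by blast
  then have "\<not> negligible (convex hull S)"
    using negligible_subset[OF _ interior_subset] open_not_negligible[OF open_interior] by blast
  moreover have "convex hull S \<in> lmeasurable"
    by (intro lmeasurable_compact compact_convex_hull finite_imp_compact assms(1))
  ultimately show ?thesis
    using negligible_iff_measure zero_less_measure_iff by blast
qed

text \<open>The dilation with centre \<open>a\<close> and factor 2 sends the two midpoints to
  \<open>b\<close> and \<open>c\<close> and preserves lines through \<open>a\<close>.\<close>

lemma not_collinear_midpoints:
  fixes a b c :: "real^2"
  assumes "\<not> collinear {a, b, c}"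
  shows "\<not> collinear {a, midpoint a b, midpoint a c}"
proof
  assume "collinear {a, midpoint a b, midpoint a c}"
  then obtain v where v: "\<exists>k. midpoint a b - a = k *\<^sub>R v" "\<exists>k. midpoint a c - a = k *\<^sub>R v"
    unfolding collinear_def by blast
  have twice: "z = a + 2 *\<^sub>R (midpoint a z - a)" for z
    by (simp add: midpoint_def vec_eq_iff algebra_simps)
  obtain k l where "b = a + (2 * k) *\<^sub>R v" "c = a + (2 * l) *\<^sub>R v"
    using v twice by (metis scaleR_scaleR)
  moreover have "a = a + 0 *\<^sub>R v" by simp
  ultimately have "collinear {a, b, c}"
    unfolding collinear_alt by blast
  with assms show False ..
qed

text \<open>The sub-cell contains the half-size triangle spanned by the node and the midpoints of
  its two edges.\<close>

lemma subcell_area_pos: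
  assumes "card (verts g c) = 3" "\<not> collinear (pos g c ` verts g c)" "p \<in> verts g c"
  shows "subcell_area g p c > 0"
proof -
  have "card (verts g c - {p}) = 2" using assms by (simp add: card_Diff_singleton)
  then obtain q r where qr: "verts g c - {p} = {q, r}" "q \<noteq> r" by (auto simp: card_2_iff)
  then have "verts g c = {p, q, r}" using assms(3) by blast
  then have "\<not> collinear {pos g c p, pos g c q, pos g c r}" using assms(2) by simp
  then show ?thesis
    unfolding subcell_area_def qr
    by (intro measure_convex_hull_pos[OF _ _ not_collinear_midpoints]) auto
qed

text \<open>The numerators add up to \<open>dual_area\<close> by definition. It is nonzero because
  every node of a triangulation is a vertex of some cell and the sub-cells have positive
  area.\<close>

lemma sum_dual_weight:
  fixes g :: "('c::finite, 'p) mesh"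
  assumes "triangulation L g"
  shows "(\<Sum>c\<in>cells_at g p. dual_weight g p c) = 1"
proof -
  have "cells_at g p \<noteq> {}"
    using assms by (auto simp: triangulation_def cells_at_def)
  moreover have "subcell_area g p c > 0" if "c \<in> cells_at g p" for c
    using assms that by (intro subcell_area_pos) (auto simp: triangulation_def cells_at_def)
  ultimately have "dual_area g p > 0"
    unfolding dual_area_def by (intro sum_pos) auto
  then show ?thesis
    by (simp add: dual_weight_def flip: sum_divide_distrib) (simp add: dual_area_def)
qed

section \<open>The dual variables and the chain rule for the energy\<close>

text \<open>The squared Frobenius norm of \<open>metric_dev\<close>, as a function of the distortion
  alone. Its derivative supplies both the entries of \<open>Gam\<close> and the chain rule.\<close>

definition shear :: "real^2^2 \<Rightarrow> real" where
  "shear A = (\<Sum>i\<in>UNIV. \<Sum>j\<in>UNIV. metric_dev A $ i $ j * metric_dev A $ i $ j)"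

text \<open>Written out, \<open>shear\<close> is a polynomial in the entries of the matrix.\<close>

lemma shear_differentiable: "shear differentiable (at A)"
proof -
  have entry: "(\<lambda>A::real^2^2. A $ i $ k) differentiable (at A)" for i k A
    by (intro bounded_linear_imp_differentiable bounded_linear_compose[OF bounded_linear_vec_nth]
        bounded_linear_vec_nth)
  have eq: "shear = (\<lambda>A. \<Sum>i\<in>UNIV. \<Sum>j\<in>UNIV.
      ((\<Sum>k\<in>UNIV. A $ k $ i * A $ k $ j) - 1/3 * (\<Sum>l\<in>UNIV. \<Sum>k\<in>UNIV. A $ k $ l * A $ k $ l) * (if i = j then 1 else 0)) *
      ((\<Sum>k\<in>UNIV. A $ k $ i * A $ k $ j) - 1/3 * (\<Sum>l\<in>UNIV. \<Sum>k\<in>UNIV. A $ k $ l * A $ k $ l) * (if i = j then 1 else 0)))"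
    unfolding shear_def metric_dev_def metric_def
    by (auto simp: fun_eq_iff matrix_matrix_mult_def transpose_def trace_def mat_def intro!: sum.cong)
  show ?thesis
    unfolding eq
    by (intro differentiable_sum finite ballI differentiable_mult differentiable_diff differentiable_const entry)
qed

text \<open>Together with the nested version for matrices, this turns the componentwise updates in
  \<open>bet\<close> and \<open>Gam\<close> into straight lines, so that partial derivatives become
  derivatives along coordinate directions.\<close>

lemma upd_vec_eq: "upd_vec v i x = v + (x - v $ i) *\<^sub>R axis i 1" for v :: "real^'n::finite"
  by (simp add: upd_vec_def vec_eq_iff axis_def)

lemma upd_vec_nested_eq:
  "upd_vec A i (upd_vec (A $ i) k x) = A + (x - A $ i $ k) *\<^sub>R axis i (axis k 1)"
  for A :: "real^'n::finite^'m::finite"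
  by (simp add: upd_vec_def vec_eq_iff axis_def)

lemma has_vector_derivative_line:
  "((\<lambda>x. a + (x - c) *\<^sub>R e) has_vector_derivative e) (at c)"
  by (auto intro!: derivative_eq_intros simp: has_vector_derivative_def)

lemma has_real_derivative_chain:
  fixes f :: "'a::real_normed_vector \<Rightarrow> real"
  assumes "(h has_vector_derivative v) (at t)" "(f has_derivative D) (at (h t))"
  shows "((\<lambda>r. f (h r)) has_real_derivative D v) (at t)"
proof -
  have "(f \<circ> h has_derivative D \<circ> (\<lambda>x. x *\<^sub>R v)) (at t)"
    using assms by (auto intro: diff_chain_at simp: has_vector_derivative_def)
  moreover have "D \<circ> (\<lambda>x. x *\<^sub>R v) = (*) (D v)"
    using has_derivative_linear[OF assms(2)] by (auto simp: linear_cmul fun_eq_iff)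
  ultimately show ?thesis
    by (simp add: has_field_derivative_def o_def)
qed

lemma has_real_derivative_along_line:
  fixes f :: "'a::real_normed_vector \<Rightarrow> real"
  assumes "(f has_derivative D) (at a)"
  shows "((\<lambda>x. f (a + (x - c) *\<^sub>R e)) has_real_derivative D e) (at c)"
  by (rule has_real_derivative_chain[OF has_vector_derivative_line]) (simp add: assms)

lemma linear_vec2_expand:
  fixes D :: "real^2 \<Rightarrow> real"
  assumes "linear D"
  shows "D v = (\<Sum>i\<in>UNIV. D (axis i 1) * v $ i)"
proof -
  have "v = (\<Sum>i\<in>UNIV. v $ i *\<^sub>R axis i 1)"
    by (simp add: vec_eq_iff forall_2 sum_2 axis_def)
  then have "D v = D (\<Sum>i\<in>UNIV. v $ i *\<^sub>R axis i 1)" by simp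
  then show ?thesis using assms by (simp add: linear_sum linear_cmul mult.commute)
qed

lemma linear_mat2_expand:
  fixes D :: "real^2^2 \<Rightarrow> real"
  assumes "linear D"
  shows "D A = (\<Sum>i\<in>UNIV. \<Sum>k\<in>UNIV. D (axis i (axis k 1)) * A $ i $ k)"
proof -
  have "A = (\<Sum>i\<in>UNIV. \<Sum>k\<in>UNIV. A $ i $ k *\<^sub>R axis i (axis k 1))"
    by (simp add: vec_eq_iff forall_2 sum_2 axis_def)
  then have "D A = D (\<Sum>i\<in>UNIV. \<Sum>k\<in>UNIV. A $ i $ k *\<^sub>R axis i (axis k 1))" by simp
  then show ?thesis using assms by (simp add: linear_sum linear_cmul mult.commute)
qed

lemma deriv_vec_nth:
  fixes f :: "real \<Rightarrow> real^'n::finite"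
  assumes "(f has_vector_derivative f') (at t)"
  shows "deriv (\<lambda>r. f r $ i) t = f' $ i"
proof -
  have "((\<lambda>r. f r $ i) has_vector_derivative f' $ i) (at t)"
    by (rule bounded_linear.has_vector_derivative[OF bounded_linear_vec_nth assms])
  then show ?thesis
    by (intro DERIV_imp_deriv) (simp add: has_real_derivative_iff_has_vector_derivative)
qed

lemma deriv_mat_nth:
  fixes f :: "real \<Rightarrow> real^'n::finite^'m::finite"
  assumes "(f has_vector_derivative f') (at t)"
  shows "deriv (\<lambda>r. f r $ i $ k) t = f' $ i $ k"
  using deriv_vec_nth[OF bounded_linear.has_vector_derivative[OF bounded_linear_vec_nth assms]] .

lemma energy_eq:
  "energy M s = eos M (svol s) (entr s) + 1/2 * (velo s \<bullet> velo s)
     + 1/4 * (c_s M)\<^sup>2 * shear (dstn s) + 1/2 * (c_h M)\<^sup>2 * (impl s \<bullet> impl s)"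
  by (simp add: energy_def shear_def power2_norm_eq_inner)

text \<open>Only \<open>eos\<close> depends on volume and entropy; the rest of the energy is the
  constant \<open>C\<close>. The partial derivatives of \<open>eos\<close> are the values of
  \<open>D\<close> on the two unit vectors.\<close>

lemma press_temp_eq:
  assumes "((\<lambda>(vol, S). eos M vol S) has_derivative D) (at (svol s, entr s))"
  shows "press M s = - D (1, 0)" "temp M s = D (0, 1)"
proof -
  define C where "C = energy M s - eos M (svol s) (entr s)"
  have E: "energy M (s\<lparr>svol := x\<rparr>) = eos M x (entr s) + C"
    "energy M (s\<lparr>entr := x\<rparr>) = eos M (svol s) x + C" for x
    by (simp_all add: C_def energy_eq)
  have "((\<lambda>x. eos M x (entr s)) has_real_derivative D (1, 0)) (at (svol s))"
    "((\<lambda>x. eos M (svol s) x) has_real_derivative D (0, 1)) (at (entr s))"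
    using has_real_derivative_along_line[OF assms, of "svol s" "(1, 0)"]
      has_real_derivative_along_line[OF assms, of "entr s" "(0, 1)"]
    by simp_all
  from this[THEN DERIV_add, OF DERIV_const, of C]
  show "press M s = - D (1, 0)" "temp M s = D (0, 1)"
    unfolding press_def temp_def E by (simp_all add: DERIV_imp_deriv)
qed

text \<open>Only the \<open>shear\<close> term varies with the distortion. Its derivative on basis
  matrices is kept as it stands, since the chain rule produces it in this form.\<close>

lemma Gam_eq:
  assumes "(shear has_derivative D) (at (dstn s))"
  shows "Gam M s $ i $ k = 1/4 * (c_s M)\<^sup>2 * D (axis i (axis k 1))"
proof -
  define C where "C = energy M s - 1/4 * (c_s M)\<^sup>2 * shear (dstn s)"
  have "energy M (s\<lparr>dstn := upd_vec (dstn s) i (upd_vec (dstn s $ i) k x)\<rparr>)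
      = C + 1/4 * (c_s M)\<^sup>2 * shear (dstn s + (x - dstn s $ i $ k) *\<^sub>R axis i (axis k 1))" for x
    by (simp add: energy_eq upd_vec_nested_eq C_def)
  moreover have "((\<lambda>x. C + 1/4 * (c_s M)\<^sup>2 * shear (dstn s + (x - dstn s $ i $ k) *\<^sub>R axis i (axis k 1)))
      has_real_derivative 0 + 1/4 * (c_s M)\<^sup>2 * D (axis i (axis k 1))) (at (dstn s $ i $ k))"
    by (intro DERIV_add DERIV_const DERIV_cmult has_real_derivative_along_line[OF assms])
  ultimately show ?thesis
    by (simp add: Gam_def DERIV_imp_deriv)
qed

lemma bet_eq: "bet M s $ i = (c_h M)\<^sup>2 * impl s $ i"
proof -
  define C where "C = energy M s - 1/2 * (c_h M)\<^sup>2 * (impl s \<bullet> impl s)"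
  define q where "q v = v \<bullet> v" for v :: "real^2"
  have q: "(q has_derivative (\<lambda>h. 2 * (impl s \<bullet> h))) (at (impl s))"
    unfolding q_def by (auto intro!: derivative_eq_intros simp: inner_commute)
  have "energy M (s\<lparr>impl := upd_vec (impl s) i x\<rparr>)
      = C + 1/2 * (c_h M)\<^sup>2 * q (impl s + (x - impl s $ i) *\<^sub>R axis i 1)" for x
    by (simp add: energy_eq upd_vec_eq C_def q_def)
  moreover have "((\<lambda>x. C + 1/2 * (c_h M)\<^sup>2 * q (impl s + (x - impl s $ i) *\<^sub>R axis i 1))
      has_real_derivative 0 + 1/2 * (c_h M)\<^sup>2 * (2 * (impl s \<bullet> axis i 1))) (at (impl s $ i))"
    by (intro DERIV_add DERIV_const DERIV_cmult has_real_derivative_along_line[OF q])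
  ultimately show ?thesis
    by (simp add: bet_def DERIV_imp_deriv inner_axis)
qed

text \<open>The Gibbs identity. The energy is a sum of terms in separate groups of variables. Only
  \<open>eos\<close> couples two of them, and its total differentiability on \<open>U\<close> lets
  its partial derivatives determine the derivative along the path.\<close>

lemma energy_has_derivative:
  fixes u :: "real \<Rightarrow> cell_state"
  assumes M: "admissible_model U M" "(svol (u t), entr (u t)) \<in> U"
    and diff: "(\<lambda>r. svol (u r)) differentiable (at t)" "(\<lambda>r. entr (u r)) differentiable (at t)"
      "(\<lambda>r. velo (u r)) differentiable (at t)" "(\<lambda>r. dstn (u r)) differentiable (at t)"
      "(\<lambda>r. impl (u r)) differentiable (at t)"
  shows "((\<lambda>r. energy M (u r)) has_real_derivative
     - press M (u t) * deriv (\<lambda>r. svol (u r)) t + temp M (u t) * deriv (\<lambda>r. entr (u r)) t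
     + (\<Sum>i\<in>UNIV. velo (u t) $ i * deriv (\<lambda>r. velo (u r) $ i) t)
     + (\<Sum>i\<in>UNIV. \<Sum>k\<in>UNIV. Gam M (u t) $ i $ k * deriv (\<lambda>r. dstn (u r) $ i $ k) t)
     + (\<Sum>i\<in>UNIV. bet M (u t) $ i * deriv (\<lambda>r. impl (u r) $ i) t)) (at t)"
proof -
  obtain v' A' J' where
    v: "((\<lambda>r. velo (u r)) has_vector_derivative v') (at t)" and
    A: "((\<lambda>r. dstn (u r)) has_vector_derivative A') (at t)" and
    J: "((\<lambda>r. impl (u r)) has_vector_derivative J') (at t)"
    using diff by (meson vector_derivative_works)
  obtain \<tau>' S' where
    \<tau>: "((\<lambda>r. svol (u r)) has_vector_derivative \<tau>') (at t)" "deriv (\<lambda>r. svol (u r)) t = \<tau>'" and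
    S: "((\<lambda>r. entr (u r)) has_vector_derivative S') (at t)" "deriv (\<lambda>r. entr (u r)) t = S'"
    using diff(1,2)
    by (metis DERIV_imp_deriv has_real_derivative_iff_has_vector_derivative vector_derivative_works)
  obtain D where D: "((\<lambda>(vol, S). eos M vol S) has_derivative D) (at (svol (u t), entr (u t)))"
    using M by (auto simp: admissible_model_def differentiable_def)
  obtain W where W: "(shear has_derivative W) (at (dstn (u t)))"
    using shear_differentiable by (auto simp: differentiable_def)
  interpret D: linear D using D by (rule has_derivative_linear)
  have "((\<lambda>r. eos M (svol (u r)) (entr (u r))) has_real_derivative D (\<tau>', S')) (at t)"
    using has_real_derivative_chain[OF has_vector_derivative_Pair[OF \<tau>(1) S(1)] D] by simp
  moreover have "D (\<tau>', S') = \<tau>' * D (1, 0) + S' * D (0, 1)"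
    using D.add[of "\<tau>' *\<^sub>R (1, 0)" "S' *\<^sub>R (0, 1)"] by (simp only: D.scaleR) simp
  ultimately have 1: "((\<lambda>r. eos M (svol (u r)) (entr (u r))) has_real_derivative
      - press M (u t) * \<tau>' + temp M (u t) * S') (at t)"
    by (simp add: press_temp_eq[OF D] mult.commute)
  have sq: "((\<lambda>r. f r \<bullet> f r) has_real_derivative 2 * (f t \<bullet> f')) (at t)"
    if "(f has_vector_derivative f') (at t)" for f :: "real \<Rightarrow> real^2" and f'
    using that
    by (auto intro!: derivative_eq_intros simp: has_field_derivative_def has_vector_derivative_def inner_commute)
  have 3: "((\<lambda>r. shear (dstn (u r))) has_real_derivative W A') (at t)"
    by (rule has_real_derivative_chain[OF A W])
  have "((\<lambda>r. energy M (u r)) has_real_derivative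
      (- press M (u t) * \<tau>' + temp M (u t) * S') + velo (u t) \<bullet> v'
      + 1/4 * (c_s M)\<^sup>2 * W A' + (c_h M)\<^sup>2 * (impl (u t) \<bullet> J')) (at t)"
    unfolding energy_eq
    by (rule derivative_eq_intros 1 3 sq[OF v] sq[OF J] refl)+ simp
  moreover have "1/4 * (c_s M)\<^sup>2 * W A' = (\<Sum>i\<in>UNIV. \<Sum>k\<in>UNIV. Gam M (u t) $ i $ k * A' $ i $ k)"
    unfolding linear_mat2_expand[OF has_derivative_linear[OF W], of A'] Gam_eq[OF W]
    by (simp add: sum_distrib_left mult.assoc)
  moreover have "(c_h M)\<^sup>2 * (impl (u t) \<bullet> J') = (\<Sum>i\<in>UNIV. bet M (u t) $ i * J' $ i)"
    by (simp add: bet_eq inner_vec_def sum_distrib_left mult.assoc)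
  ultimately show ?thesis
    by (simp add: \<tau>(2) S(2) deriv_vec_nth[OF v] deriv_mat_nth[OF A] deriv_vec_nth[OF J] inner_vec_def)
qed

section \<open>Fluctuations, fluxes and nodal compatibility\<close>

lemma len_nrm: "len g p c * nrm g p c $ k = corner g p c $ k"
  by (cases "corner g p c = 0") (simp_all add: len_def nrm_def sgn_div_norm)

lemma stress_nth:
  "stress M s $ l $ k = dens s * ((\<Sum>i\<in>UNIV. dstn s $ i $ l * Gam M s $ i $ k) + impl s $ l * bet M s $ k)"
  by (simp add: stress_def outer_def matrix_matrix_mult_def transpose_def algebra_simps)

text \<open>The share of the corner of \<open>c\<close> at \<open>p\<close> in the energy
  fluctuations of \<open>nodal_compatibility\<close>. Up to sign it is also what this corner
  contributes to the energy rate of \<open>c\<close>, apart from production and the terms with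
  \<alpha> and \<epsilon>.\<close>

definition fluctuation ::
  "model \<Rightarrow> ('c, 'p) mesh \<Rightarrow> ('c \<Rightarrow> cell_state) \<Rightarrow> 'p \<Rightarrow> 'c \<Rightarrow> real" where
  "fluctuation M g s p c = (\<Sum>k\<in>UNIV. len g p c * nrm g p c $ k *
       (press M (s c) * (nvel g s p $ k - velo (s c) $ k)
        + velo (s c) $ k * (npress M g s p - press M (s c))
        + (\<Sum>i\<in>UNIV. (nstress M g s p $ i $ k - stress M (s c) $ i $ k) * velo (s c) $ i)
        + temp M (s c) * (ndens g s p * nbet M g s p $ k - dens (s c) * bet M (s c) $ k)
        + (\<Sum>i\<in>UNIV. \<Sum>l\<in>UNIV. dens (s c) * Gam M (s c) $ i $ k * dstn (s c) $ i $ l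
             * (nvel g s p $ l - velo (s c) $ l))
        + (\<Sum>l\<in>UNIV. dens (s c) * bet M (s c) $ k * impl (s c) $ l * (nvel g s p $ l - velo (s c) $ l))
        + dens (s c) * bet M (s c) $ k * (ntemp M g s p - temp M (s c))))"

text \<open>The energy flux: power of pressure and stress plus heat flux. It depends on the cell
  state alone, so it factors out of a sum of corner normals.\<close>

definition flux_density :: "model \<Rightarrow> cell_state \<Rightarrow> real^2" where
  "flux_density M s = (\<chi> k. press M s * velo s $ k + (\<Sum>i\<in>UNIV. stress M s $ i $ k * velo s $ i)
     + dens s * temp M s * bet M s $ k)"

text \<open>The factor of \<alpha> + \<epsilon> in the energy balance of \<open>c\<close>: the
  velocity correction weighted with the velocity, plus the impulse correction weighted with
  \<beta>.\<close>

definition dissipation ::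
  "model \<Rightarrow> ('c, 'p) mesh \<Rightarrow> ('c \<Rightarrow> cell_state) \<Rightarrow> 'p \<Rightarrow> 'c \<Rightarrow> real" where
  "dissipation M g s p c = len g p c * (velo (s c) \<bullet> (velo (s c) - nvel g s p))
     + Dnode M g s p * (len g p c * (nrm g p c \<bullet> (dens (s c) *\<^sub>R bet M (s c))))"

lemma nodal_compatibility_iff:
  "nodal_compatibility M g s p a \<longleftrightarrow>
     (\<Sum>c\<in>cells_at g p. fluctuation M g s p c) + a * delta M g s p
     = - (\<Sum>c\<in>cells_at g p. corner g p c \<bullet> flux_density M (s c))"
  by (simp add: nodal_compatibility_def fluctuation_def flux_density_def inner_vec_def
      flip: len_nrm)

text \<open>The stress tensor has the form that makes the distortion and impulse equations work on a
  velocity difference \<open>d\<close> through the same tensor that drives the velocity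
  equation.\<close>

lemma stress_power:
  "(\<Sum>i\<in>UNIV. \<Sum>l\<in>UNIV. dens s * Gam M s $ i $ k * dstn s $ i $ l * d $ l)
     + (\<Sum>l\<in>UNIV. dens s * bet M s $ k * impl s $ l * d $ l)
   = (\<Sum>l\<in>UNIV. stress M s $ l $ k * d $ l)"
  unfolding stress_nth sum_2 by (simp add: algebra_simps)

text \<open>By \<open>stress_power\<close> the terms with \<open>A\<close> and \<open>J\<close> in the fluctuations recombine to the stress acting
  on \<open>v\<^sub>p - v\<^sub>c\<close>, so that \<open>\<nu>\<^sub>p\<close> is what the fluctuations lack to match the flux.\<close>

lemma nodal_compatibility_alpha:
  assumes "delta M g s p \<noteq> 0"
  shows "nodal_compatibility M g s p (alpha M g s p)"
proof -
  have "(\<Sum>c\<in>cells_at g p. fluctuation M g s p c) + nu M g s p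
      = - (\<Sum>c\<in>cells_at g p. corner g p c \<bullet> flux_density M (s c))"
    unfolding nu_def fluctuation_def inner_vec_def sum.distrib[symmetric] sum_negf[symmetric] len_nrm
      inner_real_def distrib_left[symmetric]
  \<comment> \<open>The identity holds for each cell and each component separately.\<close>
  proof (intro sum.cong refl, goal_cases)
    case (1 c k)
    have power: "(\<Sum>i\<in>UNIV. \<Sum>l\<in>UNIV. dens (s c) * Gam M (s c) $ i $ k * dstn (s c) $ i $ l
             * (nvel g s p $ l - velo (s c) $ l))
        = (\<Sum>l\<in>UNIV. stress M (s c) $ l $ k * (nvel g s p $ l - velo (s c) $ l))
        - (\<Sum>l\<in>UNIV. dens (s c) * bet M (s c) $ k * impl (s c) $ l * (nvel g s p $ l - velo (s c) $ l))"
      using stress_power[where s = "s c" and M = M and k = k and d = "nvel g s p - velo (s c)"] by simp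
    show ?case
      unfolding power flux_density_def vec_lambda_beta mult_minus_right[symmetric]
      unfolding sum_2 by (intro arg_cong[where f = "(*) _"]) (simp add: algebra_simps)
  qed
  then show ?thesis
    using assms by (simp add: nodal_compatibility_iff alpha_def)
qed

section \<open>Averages and dissipation around a node\<close>

text \<open>Deviations from a weighted mean cancel. If the total weight is zero, all weights vanish
  because they are nonnegative, and so does every summand.\<close>

lemma sum_len_deviation_eq_0:
  fixes g :: "('c::finite, 'p) mesh" and q :: "'c \<Rightarrow> 'a::real_vector"
  shows "(\<Sum>c\<in>cells_at g p. len g p c *\<^sub>R (q c - node_avg g q p)) = 0"
proof (cases "(\<Sum>c\<in>cells_at g p. len g p c) = 0")
  case True
  then have "len g p c = 0" if "c \<in> cells_at g p" for c
    using that by (subst (asm) sum_nonneg_eq_0_iff) (auto simp: len_def)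
  then show ?thesis by simp
next
  case False
  then have "(\<Sum>c\<in>cells_at g p. len g p c) *\<^sub>R node_avg g q p = (\<Sum>c\<in>cells_at g p. len g p c *\<^sub>R q c)"
    by (simp add: node_avg_def)
  then show ?thesis
    by (simp add: scaleR_diff_right sum_subtractf scaleR_left.sum)
qed

text \<open>Replacing the first \<open>velo (s c)\<close> by its deviation from the nodal velocity
  changes the sum by the nodal velocity times the summed weighted deviations, which is zero. The
  impulse parts add up to the square of \<open>Dnode\<close>.\<close>

lemma sum_dissipation:
  fixes g :: "('c::finite, 'p) mesh"
  shows "(\<Sum>c\<in>cells_at g p. dissipation M g s p c) = delta M g s p"
proof -
  let ?d = "\<lambda>c. velo (s c) - nvel g s p"
  have "(\<Sum>c\<in>cells_at g p. len g p c * (velo (s c) \<bullet> ?d c)) - (\<Sum>c\<in>cells_at g p. len g p c * (norm (?d c))\<^sup>2)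
      = nvel g s p \<bullet> (\<Sum>c\<in>cells_at g p. len g p c *\<^sub>R ?d c)"
    unfolding sum_subtractf[symmetric] inner_sum_right
    by (rule sum.cong) (simp_all add: power2_norm_eq_inner inner_simps algebra_simps)
  then show ?thesis
    by (simp add: sum_len_deviation_eq_0 dissipation_def delta_def sum.distrib Dnode_def
        power2_eq_square flip: sum_distrib_left)
qed

section \<open>Energy balance of a single cell\<close>

text \<open>Each evolution equation is multiplied by its dual variable and the results are added
  according to the Gibbs identity; the terms are then sorted by the vertices of the cell.\<close>

lemma cell_energy_balance:
  fixes K :: "'c::finite \<Rightarrow> 'p::finite set" and off x u m and t :: real and c :: 'c
  defines "g \<equiv> mesh_at K off x t" and "s \<equiv> (\<lambda>c. u c t)"
  assumes M: "admissible_model U M" and scheme: "htc_scheme w M U eps m K off x u t"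
  shows "(\<lambda>r. energy M (u c r)) differentiable (at t)"
    and "m c * deriv (\<lambda>r. energy M (u c r)) t =
      temp M (s c) * Pi_cell w M (\<lambda>p. eps p t) g s c
      - (\<Sum>p\<in>verts g c. fluctuation M g s p c + (alpha M g s p + eps p t) * dissipation M g s p c)"
proof -
  define e where "e = (\<lambda>p. eps p t)"
  define \<tau>' where "\<tau>' = deriv (\<lambda>r. svol (u c r)) t"
  define S' where "S' = deriv (\<lambda>r. entr (u c r)) t"
  define v' where "v' i = deriv (\<lambda>r. velo (u c r) $ i) t" for i
  define A' where "A' i k = deriv (\<lambda>r. dstn (u c r) $ i $ k) t" for i k
  define J' where "J' i = deriv (\<lambda>r. impl (u c r) $ i) t" for i
  have at_t: "u d t = s d" "eps p t = e p" for d p by (simp_all add: s_def e_def)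
  note sch = scheme[unfolded htc_scheme_def Let_def, folded g_def, THEN conjunct2,
      THEN spec[of _ c], folded \<tau>'_def S'_def v'_def A'_def J'_def, unfolded at_t]
  define n where "n p k = len g p c * nrm g p c $ k" for p k
  have T: "temp M (s c) > 0" using sch by blast
  have \<tau>_eq: "m c * \<tau>' - (\<Sum>p\<in>verts g c. len g p c * (nrm g p c \<bullet> (nvel g s p - velo (s c)))) = 0"
    using sch by blast
  have S_eq: "m c * S' + (\<Sum>p\<in>verts g c. len g p c *
         (nrm g p c \<bullet> (ndens g s p *\<^sub>R nbet M g s p - dens (s c) *\<^sub>R bet M (s c))))
      = Pi_cell w M e g s c + pi_cell M (s c)"
    using sch by blast
  have v_eq: "m c * v' i
      + (\<Sum>p\<in>verts g c. n p i * (npress M g s p - press M (s c))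
          + (\<Sum>k\<in>UNIV. n p k * (nstress M g s p $ i $ k - stress M (s c) $ i $ k)))
      + (\<Sum>p\<in>verts g c. len g p c * (alpha M g s p + e p) * (velo (s c) $ i - nvel g s p $ i)) = 0" for i
    using sch unfolding n_def by blast
  have A_eq: "m c * A' i k + (\<Sum>l\<in>UNIV. dens (s c) * dstn (s c) $ i $ l *
         (\<Sum>p\<in>verts g c. n p k * (nvel g s p $ l - velo (s c) $ l)))
      = - (1 / theta1 M) * Gam M (s c) $ i $ k" for i k
    using sch unfolding n_def by blast
  have J_eq: "m c * J' i + (\<Sum>l\<in>UNIV. dens (s c) * impl (s c) $ l *
         (\<Sum>p\<in>verts g c. n p i * (nvel g s p $ l - velo (s c) $ l)))
      + dens (s c) * (\<Sum>p\<in>verts g c. n p i * (ntemp M g s p - temp M (s c)))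
      + dens (s c) * (\<Sum>p\<in>verts g c. n p i * (alpha M g s p + e p) * Dnode M g s p)
      = - (1 / theta2 M) * bet M (s c) $ i" for i
    using sch unfolding n_def by blast
  have deriv: "((\<lambda>r. energy M (u c r)) has_real_derivative
     - press M (s c) * \<tau>' + temp M (s c) * S' + (\<Sum>i\<in>UNIV. velo (s c) $ i * v' i)
     + (\<Sum>i\<in>UNIV. \<Sum>k\<in>UNIV. Gam M (s c) $ i $ k * A' i k)
     + (\<Sum>i\<in>UNIV. bet M (s c) $ i * J' i)) (at t)"
    unfolding s_def \<tau>'_def S'_def v'_def A'_def J'_def
    by (rule energy_has_derivative[OF M]) (use sch in \<open>simp_all add: s_def\<close>)
  then show "(\<lambda>r. energy M (u c r)) differentiable (at t)"
    by (auto simp: real_differentiable_def)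
  \<comment> \<open>The functions \<open>f\<tau>\<close>, \<open>fS\<close>, \<open>fv\<close>,
    \<open>fA\<close>, \<open>fJ\<close> hold what one node contributes to each weighted equation,
    moved to the right-hand side and without the production and relaxation terms.\<close>
  define f\<tau> where "f\<tau> p = - press M (s c) * (\<Sum>k\<in>UNIV. n p k * (nvel g s p $ k - velo (s c) $ k))" for p
  define fS where "fS p = - temp M (s c) *
      (\<Sum>k\<in>UNIV. n p k * (ndens g s p * nbet M g s p $ k - dens (s c) * bet M (s c) $ k))" for p
  define fv where "fv i p = - velo (s c) $ i * (n p i * (npress M g s p - press M (s c))
      + (\<Sum>k\<in>UNIV. n p k * (nstress M g s p $ i $ k - stress M (s c) $ i $ k))
      + len g p c * (alpha M g s p + e p) * (velo (s c) $ i - nvel g s p $ i))" for i p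
  define fA where "fA i k p = - Gam M (s c) $ i $ k *
      (\<Sum>l\<in>UNIV. dens (s c) * dstn (s c) $ i $ l * (n p k * (nvel g s p $ l - velo (s c) $ l)))" for i k p
  define fJ where "fJ i p = - bet M (s c) $ i *
      ((\<Sum>l\<in>UNIV. dens (s c) * impl (s c) $ l * (n p i * (nvel g s p $ l - velo (s c) $ l)))
       + dens (s c) * (n p i * (ntemp M g s p - temp M (s c)))
       + dens (s c) * (n p i * (alpha M g s p + e p) * Dnode M g s p))" for i p
  let ?P = "verts g c"
  have \<tau>: "m c * \<tau>' * - press M (s c) = (\<Sum>p\<in>?P. f\<tau> p)"
  proof -
    have "m c * \<tau>' = (\<Sum>p\<in>?P. \<Sum>k\<in>UNIV. n p k * (nvel g s p $ k - velo (s c) $ k))"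
      using \<tau>_eq by (simp add: n_def inner_vec_def sum_distrib_left mult.assoc)
    then show ?thesis
      by (simp add: f\<tau>_def sum_distrib_left mult.commute sum_negf)
  qed
  have S: "m c * S' * temp M (s c) = (\<Sum>p\<in>?P. fS p) + temp M (s c) * Pi_cell w M e g s c
      + (\<Sum>i\<in>UNIV. \<Sum>k\<in>UNIV. Gam M (s c) $ i $ k * Gam M (s c) $ i $ k) / theta1 M
      + (\<Sum>i\<in>UNIV. bet M (s c) $ i * bet M (s c) $ i) / theta2 M"
  proof -
    define Q where "Q = (\<Sum>p\<in>?P. \<Sum>k\<in>UNIV. n p k *
        (ndens g s p * nbet M g s p $ k - dens (s c) * bet M (s c) $ k))"
    have "m c * S' = Pi_cell w M e g s c + pi_cell M (s c) - Q"
      using S_eq by (simp add: Q_def n_def inner_vec_def sum_distrib_left mult.assoc)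
    then have "m c * S' * temp M (s c) = (Pi_cell w M e g s c + pi_cell M (s c) - Q) * temp M (s c)"
      by (rule arg_cong)
    then have "m c * S' * temp M (s c)
        = temp M (s c) * Pi_cell w M e g s c + temp M (s c) * pi_cell M (s c) - temp M (s c) * Q"
      by (simp add: algebra_simps)
    \<comment> \<open>The positive temperature cancels the one in the denominators of
      \<open>pi_cell\<close>.\<close>
    moreover have "temp M (s c) * pi_cell M (s c) =
        (\<Sum>i\<in>UNIV. \<Sum>k\<in>UNIV. Gam M (s c) $ i $ k * Gam M (s c) $ i $ k) / theta1 M
        + (\<Sum>i\<in>UNIV. bet M (s c) $ i * bet M (s c) $ i) / theta2 M"
      using T by (simp add: pi_cell_def inner_vec_def distrib_left)
    moreover have "(\<Sum>p\<in>?P. fS p) = - (temp M (s c) * Q)"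
      unfolding fS_def Q_def by (simp add: sum_distrib_left sum_negf)
    ultimately show ?thesis by linarith
  qed
  have v: "velo (s c) $ i * (m c * v' i) = (\<Sum>p\<in>?P. fv i p)" for i
  proof -
    have "m c * v' i = - (\<Sum>p\<in>?P. n p i * (npress M g s p - press M (s c))
        + (\<Sum>k\<in>UNIV. n p k * (nstress M g s p $ i $ k - stress M (s c) $ i $ k))
        + len g p c * (alpha M g s p + e p) * (velo (s c) $ i - nvel g s p $ i))"
      using v_eq[of i] unfolding sum.distrib by linarith
    then show ?thesis
      unfolding fv_def sum_distrib_left[symmetric] by simp
  qed
  have A: "Gam M (s c) $ i $ k * (m c * A' i k) =
      (\<Sum>p\<in>?P. fA i k p) - Gam M (s c) $ i $ k * Gam M (s c) $ i $ k / theta1 M" for i k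
  proof -
    have "m c * A' i k = - (1 / theta1 M) * Gam M (s c) $ i $ k -
        (\<Sum>l\<in>UNIV. dens (s c) * dstn (s c) $ i $ l * (\<Sum>p\<in>?P. n p k * (nvel g s p $ l - velo (s c) $ l)))"
      using A_eq[of i k] by linarith
    also have "(\<Sum>l\<in>UNIV. dens (s c) * dstn (s c) $ i $ l * (\<Sum>p\<in>?P. n p k * (nvel g s p $ l - velo (s c) $ l)))
        = (\<Sum>p\<in>?P. \<Sum>l\<in>UNIV. dens (s c) * dstn (s c) $ i $ l * (n p k * (nvel g s p $ l - velo (s c) $ l)))"
      unfolding sum_distrib_left by (rule sum.swap)
    finally have eq: "m c * A' i k = - (1 / theta1 M) * Gam M (s c) $ i $ k - \<dots>" .
    show ?thesis
      unfolding eq fA_def sum_distrib_left[symmetric] by (simp add: algebra_simps)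
  qed
  have J: "bet M (s c) $ i * (m c * J' i) =
      (\<Sum>p\<in>?P. fJ i p) - bet M (s c) $ i * bet M (s c) $ i / theta2 M" for i
  proof -
    have "m c * J' i = - (1 / theta2 M) * bet M (s c) $ i -
        (\<Sum>l\<in>UNIV. dens (s c) * impl (s c) $ l * (\<Sum>p\<in>?P. n p i * (nvel g s p $ l - velo (s c) $ l)))
        - dens (s c) * (\<Sum>p\<in>?P. n p i * (ntemp M g s p - temp M (s c)))
        - dens (s c) * (\<Sum>p\<in>?P. n p i * (alpha M g s p + e p) * Dnode M g s p)"
      using J_eq[of i] by linarith
    also have "(\<Sum>l\<in>UNIV. dens (s c) * impl (s c) $ l * (\<Sum>p\<in>?P. n p i * (nvel g s p $ l - velo (s c) $ l)))
        = (\<Sum>p\<in>?P. \<Sum>l\<in>UNIV. dens (s c) * impl (s c) $ l * (n p i * (nvel g s p $ l - velo (s c) $ l)))"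
      unfolding sum_distrib_left by (rule sum.swap)
    finally have eq: "m c * J' i = - (1 / theta2 M) * bet M (s c) $ i - \<dots>
        - dens (s c) * (\<Sum>p\<in>?P. n p i * (ntemp M g s p - temp M (s c)))
        - dens (s c) * (\<Sum>p\<in>?P. n p i * (alpha M g s p + e p) * Dnode M g s p)" .
    show ?thesis
      unfolding eq fJ_def sum_distrib_left[symmetric] sum.distrib by (simp add: algebra_simps)
  qed
  \<comment> \<open>The correction terms of \<open>fv\<close> and \<open>fJ\<close> form the
    dissipation; all other terms regroup into the fluctuation.\<close>
  have local: "f\<tau> p + fS p + (\<Sum>i\<in>UNIV. fv i p) + (\<Sum>i\<in>UNIV. \<Sum>k\<in>UNIV. fA i k p) + (\<Sum>i\<in>UNIV. fJ i p)
      = - (fluctuation M g s p c + (alpha M g s p + e p) * dissipation M g s p c)" for p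
  proof -
    have 1: "f\<tau> p = - (\<Sum>k\<in>UNIV. n p k * (press M (s c) * (nvel g s p $ k - velo (s c) $ k)))"
      "fS p = - (\<Sum>k\<in>UNIV. n p k *
        (temp M (s c) * (ndens g s p * nbet M g s p $ k - dens (s c) * bet M (s c) $ k)))"
      unfolding f\<tau>_def fS_def sum_2 by (simp_all add: algebra_simps)
    have 2: "(\<Sum>i\<in>UNIV. fv i p) =
        - (\<Sum>k\<in>UNIV. n p k * (velo (s c) $ k * (npress M g s p - press M (s c))))
        - (\<Sum>k\<in>UNIV. n p k * (\<Sum>i\<in>UNIV. (nstress M g s p $ i $ k - stress M (s c) $ i $ k) * velo (s c) $ i))
        - (alpha M g s p + e p) * (len g p c * (velo (s c) \<bullet> (velo (s c) - nvel g s p)))"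
      unfolding fv_def inner_vec_def sum_2 by (simp add: algebra_simps)
    have 3: "(\<Sum>i\<in>UNIV. \<Sum>k\<in>UNIV. fA i k p) =
        - (\<Sum>k\<in>UNIV. n p k * (\<Sum>i\<in>UNIV. \<Sum>l\<in>UNIV. dens (s c) * Gam M (s c) $ i $ k
            * dstn (s c) $ i $ l * (nvel g s p $ l - velo (s c) $ l)))"
      unfolding fA_def sum_2 by (simp add: algebra_simps)
    have 4: "(\<Sum>i\<in>UNIV. fJ i p) =
        - (\<Sum>k\<in>UNIV. n p k * (\<Sum>l\<in>UNIV. dens (s c) * bet M (s c) $ k * impl (s c) $ l
            * (nvel g s p $ l - velo (s c) $ l)))
        - (\<Sum>k\<in>UNIV. n p k * (dens (s c) * bet M (s c) $ k * (ntemp M g s p - temp M (s c))))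
        - (alpha M g s p + e p) *
            (Dnode M g s p * (len g p c * (nrm g p c \<bullet> (dens (s c) *\<^sub>R bet M (s c)))))"
      unfolding fJ_def inner_vec_def sum_2 n_def by (simp add: algebra_simps)
    show ?thesis
      unfolding 1 2 3 4 fluctuation_def dissipation_def n_def[symmetric] distrib_left sum.distrib
      by linarith
  qed
  have "m c * deriv (\<lambda>r. energy M (u c r)) t =
      m c * \<tau>' * - press M (s c) + m c * S' * temp M (s c)
      + (\<Sum>i\<in>UNIV. velo (s c) $ i * (m c * v' i))
      + (\<Sum>i\<in>UNIV. \<Sum>k\<in>UNIV. Gam M (s c) $ i $ k * (m c * A' i k))
      + (\<Sum>i\<in>UNIV. bet M (s c) $ i * (m c * J' i))"
    unfolding DERIV_imp_deriv[OF deriv] sum_2 by (simp add: algebra_simps)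
  \<comment> \<open>The relaxation terms enter with a plus sign through \<open>S\<close> and with a
    minus sign through \<open>A\<close> and \<open>J\<close>, so they cancel here.\<close>
  also have "\<dots> = temp M (s c) * Pi_cell w M e g s c + ((\<Sum>p\<in>?P. f\<tau> p) + (\<Sum>p\<in>?P. fS p)
      + (\<Sum>i\<in>UNIV. \<Sum>p\<in>?P. fv i p) + (\<Sum>i\<in>UNIV. \<Sum>k\<in>UNIV. \<Sum>p\<in>?P. fA i k p)
      + (\<Sum>i\<in>UNIV. \<Sum>p\<in>?P. fJ i p))"
    unfolding \<tau> S v A J by (simp add: sum_subtractf flip: sum_divide_distrib)
  also have "\<dots> = temp M (s c) * Pi_cell w M e g s c + (\<Sum>p\<in>?P. f\<tau> p + fS p + (\<Sum>i\<in>UNIV. fv i p)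
      + (\<Sum>i\<in>UNIV. \<Sum>k\<in>UNIV. fA i k p) + (\<Sum>i\<in>UNIV. fJ i p))"
    unfolding sum_2 sum.distrib by simp
  finally show "m c * deriv (\<lambda>r. energy M (u c r)) t =
      temp M (s c) * Pi_cell w M (\<lambda>p. eps p t) g s c
      - (\<Sum>p\<in>verts g c. fluctuation M g s p c + (alpha M g s p + eps p t) * dissipation M g s p c)"
    unfolding local sum_negf e_def by simp
qed

section \<open>Summation over the mesh and conservation of energy\<close>

lemma sum_cells_nodes_swap:
  fixes g :: "('c::finite, 'p::finite) mesh" and f :: "'p \<Rightarrow> 'c \<Rightarrow> 'a::comm_monoid_add"
  shows "(\<Sum>c\<in>UNIV. \<Sum>p\<in>verts g c. f p c) = (\<Sum>p\<in>UNIV. \<Sum>c\<in>cells_at g p. f p c)"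
  using sum.swap_restrict[of UNIV UNIV "\<lambda>c p. f p c" "\<lambda>c p. p \<in> verts g c"]
  by (simp add: cells_at_def)

text \<open>The temperature cancels, and after exchanging the sums the weights around each node add
  up to one. For \<open>cell_weight\<close> the corresponding equation is a hypothesis of the
  theorem.\<close>

lemma sum_temp_Pi_cell_dual_weight:
  fixes g :: "('c::finite, 'p::finite) mesh"
  assumes "triangulation L g" "\<And>c. temp M (s c) > 0"
  shows "(\<Sum>c\<in>UNIV. temp M (s c) * Pi_cell dual_weight M e g s c) = (\<Sum>p\<in>UNIV. Pi_node M e g s p)"
proof -
  have "temp M (s c) * Pi_cell dual_weight M e g s c
      = (\<Sum>p\<in>verts g c. dual_weight g p c * Pi_node M e g s p)" for c
    using assms(2)[of c] by (simp add: Pi_cell_def sum_distrib_left)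
  then show ?thesis
    by (simp add: sum_cells_nodes_swap sum_dual_weight[OF assms(1)] flip: sum_distrib_right)
qed

theorem theorem3p2:
  fixes K :: "'c::finite \<Rightarrow> 'p::finite set"
    and off :: "'c \<Rightarrow> 'p \<Rightarrow> real^2"
    and x :: "'p \<Rightarrow> real \<Rightarrow> real^2"
    and u :: "'c \<Rightarrow> real \<Rightarrow> cell_state"
    and m :: "'c \<Rightarrow> real"
    and eps :: "'p \<Rightarrow> real \<Rightarrow> real"
    and M :: model
    and U :: "(real \<times> real) set"
    and I :: "real set"
    and w :: "('c, 'p) mesh \<Rightarrow> 'p \<Rightarrow> 'c \<Rightarrow> real"
  assumes "open I"
    and "admissible_model U M"
    and "periodic_mesh K off x I \<or> zero_boundary_fluxes M K off x u I"
    and "\<And>t. t \<in> I \<Longrightarrow> htc_scheme w M U eps m K off x u t"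
    and "\<And>t p. t \<in> I \<Longrightarrow> delta M (mesh_at K off x t) (\<lambda>c. u c t) p = 0 \<Longrightarrow>
           nodal_compatibility M (mesh_at K off x t) (\<lambda>c. u c t) p
             (alpha M (mesh_at K off x t) (\<lambda>c. u c t) p)"
    and "w = dual_weight \<or>
         (w = cell_weight \<and>
          (\<forall>t\<in>I. (\<Sum>c\<in>UNIV. temp M (u c t) *
                      Pi_cell w M (\<lambda>p. eps p t) (mesh_at K off x t) (\<lambda>c. u c t) c)
                 = (\<Sum>p\<in>UNIV. Pi_node M (\<lambda>p. eps p t) (mesh_at K off x t) (\<lambda>c. u c t) p)))"
  shows "\<forall>t\<in>I. (\<forall>c. (\<lambda>r. energy M (u c r)) differentiable (at t)) \<and>
               (\<Sum>c\<in>UNIV. m c * deriv (\<lambda>r. energy M (u c r)) t) = 0"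
proof (intro ballI conjI allI)
  fix t assume t: "t \<in> I"
  note scheme = assms(4)[OF t]
  note balance = cell_energy_balance[OF assms(2) scheme]
  show "(\<lambda>r. energy M (u c r)) differentiable (at t)" for c
    by (rule balance(1))
  define g where "g = mesh_at K off x t"
  define s where "s = (\<lambda>c. u c t)"
  define e where "e = (\<lambda>p. eps p t)"
  \<comment> \<open>Either boundary condition supplies a triangulation modulo its periods: a lattice
    in the periodic case, \<open>{0}\<close> in the other.\<close>
  obtain L where L: "triangulation L g"
    using assms(3) t by (auto simp: periodic_mesh_def zero_boundary_fluxes_def Let_def g_def)
  have "temp M (s c) > 0" for c
    using scheme by (auto simp: htc_scheme_def Let_def s_def)
  then have production: "(\<Sum>c\<in>UNIV. temp M (s c) * Pi_cell w M e g s c) = (\<Sum>p\<in>UNIV. e p * delta M g s p)"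
    using assms(6) t sum_temp_Pi_cell_dual_weight[OF L, of M s e]
    by (auto simp: g_def s_def e_def Pi_node_def)
  \<comment> \<open>Where \<open>delta\<close> vanishes, \<open>alpha\<close> is 0 by convention and
    compatibility is a hypothesis; elsewhere it follows from \<alpha> = \<nu> / \<delta>.\<close>
  have "nodal_compatibility M g s p (alpha M g s p)" for p
    using assms(5)[OF t, of p] nodal_compatibility_alpha[of M g s p] by (auto simp: g_def s_def)
  then have compat: "(\<Sum>c\<in>cells_at g p. fluctuation M g s p c) + alpha M g s p * delta M g s p
      = - (\<Sum>c\<in>cells_at g p. corner g p c \<bullet> flux_density M (s c))" for p
    by (simp add: nodal_compatibility_iff)
  have cell: "m c * deriv (\<lambda>r. energy M (u c r)) t = temp M (s c) * Pi_cell w M e g s c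
      - (\<Sum>p\<in>verts g c. fluctuation M g s p c + (alpha M g s p + e p) * dissipation M g s p c)" for c
    unfolding g_def s_def e_def by (rule balance(2))
  have "(\<Sum>c\<in>UNIV. m c * deriv (\<lambda>r. energy M (u c r)) t)
      = (\<Sum>p\<in>UNIV. e p * delta M g s p)
        - (\<Sum>p\<in>UNIV. \<Sum>c\<in>cells_at g p. fluctuation M g s p c + (alpha M g s p + e p) * dissipation M g s p c)"
    by (simp add: cell sum_subtractf sum_cells_nodes_swap production)
  also have "\<dots> = - (\<Sum>p\<in>UNIV. (\<Sum>c\<in>cells_at g p. fluctuation M g s p c) + alpha M g s p * delta M g s p)"
    by (simp add: sum.distrib sum_dissipation algebra_simps flip: sum_distrib_left)
  \<comment> \<open>Compatibility replaces the fluctuations around each node by fluxes, which are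
    then regrouped by cell so that \<open>flux_density\<close> can be factored out.\<close>
  also have "\<dots> = (\<Sum>c\<in>UNIV. \<Sum>p\<in>verts g c. corner g p c \<bullet> flux_density M (s c))"
    by (simp add: compat sum_negf sum_cells_nodes_swap)
  also have "\<dots> = 0"
    using L by (simp add: sum_corner_eq_0 triangulation_def flip: inner_sum_left)
  finally show "(\<Sum>c\<in>UNIV. m c * deriv (\<lambda>r. energy M (u c r)) t) = 0" .
qed

end
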